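(* Let $X$ and $Y$ be Banach spaces and $T\in LR(X,Y)$. Then the following statements are equivalent: (i) $T$ and $D(T)$ are closed; (ii) $T$ is bounded, and $D(T)$ and $T(0)$ are closed; (iii) $T$ is bounded and closed.
   Context: All spaces are over the same scalar field ($\mathbf R$ or $\mathbf C$). $LR(X,Y)$ is the set of all linear subspaces of $X\times Y$. For $T\in LR(X,Y)$: $D(T)$ is its domain, $T(x)=\{y\in Y:(x,y)\in T\}$. $T$ is closed if it is closed in $X\times Y$. For $x\in D(T)$, $\|T(x)\|:=\|[y]\|$ for any $y\in T(x)$, where $[y]=y+\overline{T(0)}\in Y/\overline{T(0)}$ and $\|[y]\|=\inf\{\|y-e\|:e\in\overline{T(0)}\}$. $\|T\|:=\sup\{\|T(x)\|:x\in D(T),\ \|x\|\le1\}$, and $T$ is bounded if $\|T\|<\infty$. *)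

theory Defs
  imports "HOL-Analysis.Analysis"
begin

text \<open>
  A norm compatible with a vector space structure over \<open>'k\<close>. By the Gelfand--Mazur theorem a
  type of class \<open>real_normed_field\<close> is isometrically isomorphic to \<open>\<real>\<close> or \<open>\<complex>\<close>, so a
  \<open>'b::banach\<close> with such a scaling is exactly a real or complex Banach space. For complex \<open>'k\<close>
  the class \<open>banach\<close> supplies the norm, completeness and the underlying real structure; the
  scaling agrees with \<open>scaleR\<close> on real scalars because it is additive and continuous in the scalar.
\<close>

locale normed_vector_space_over = vector_space scale
  for scale :: "'k::real_normed_field \<Rightarrow> 'b::real_normed_vector \<Rightarrow> 'b" +
  assumes norm_scale: "norm (scale c x) = norm c * norm x"

lemma normed_vector_space_over_scaleR:
  "normed_vector_space_over (scaleR :: real \<Rightarrow> 'b::real_normed_vector \<Rightarrow> 'b)"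
  by unfold_locales (auto simp: algebra_simps)

lemma normed_vector_space_over_mult:
  "normed_vector_space_over ((*) :: complex \<Rightarrow> complex \<Rightarrow> complex)"
  by unfold_locales (auto simp: algebra_simps norm_mult)

text \<open>
  Linear relations are sets of pairs; \<open>D(T)\<close> is \<^term>\<open>Domain T\<close> and \<open>T(x)\<close> is \<^term>\<open>T `` {x}\<close>.
\<close>

definition LR ::
  "('k::real_normed_field \<Rightarrow> 'x::real_normed_vector \<Rightarrow> 'x) \<Rightarrow>
   ('k \<Rightarrow> 'y::real_normed_vector \<Rightarrow> 'y) \<Rightarrow> ('x \<times> 'y) set set"
  where "LR sX sY = {T. module.subspace (module_prod.scale sX sY) T}"

definition quot_norm :: "'y::real_normed_vector set \<Rightarrow> 'y \<Rightarrow> real"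
  where "quot_norm E y = (INF e\<in>E. norm (y - e))"

text \<open>
  Meaningful only for \<open>x\<close> in the domain, where the choice of the representative is
  irrelevant by the lemma \<open>rel_norm_at_eq\<close> below.
\<close>

definition rel_norm_at :: "('x::real_normed_vector \<times> 'y::real_normed_vector) set \<Rightarrow> 'x \<Rightarrow> real"
  where "rel_norm_at T x = quot_norm (closure (T `` {0})) (SOME y. y \<in> T `` {x})"

definition rel_norm :: "('x::real_normed_vector \<times> 'y::real_normed_vector) set \<Rightarrow> ereal"
  where "rel_norm T = (SUP x\<in>{x \<in> Domain T. norm x \<le> 1}. ereal (rel_norm_at T x))"

definition rel_bounded :: "('x::real_normed_vector \<times> 'y::real_normed_vector) set \<Rightarrow> bool"
  where "rel_bounded T \<longleftrightarrow> rel_norm T < \<infinity>"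

lemma rel_norm_at_eq:
  fixes sX :: "'k::real_normed_field \<Rightarrow> 'x::real_normed_vector \<Rightarrow> 'x"
    and sY :: "'k \<Rightarrow> 'y::real_normed_vector \<Rightarrow> 'y"
  assumes "normed_vector_space_over sX" and "normed_vector_space_over sY"
    and "T \<in> LR sX sY" and y: "y \<in> T `` {x}"
  shows "rel_norm_at T x = quot_norm (closure (T `` {0})) y"
proof -
  interpret X: normed_vector_space_over sX by fact
  interpret Y: normed_vector_space_over sY by fact
  interpret P: vector_space_prod sX sY by unfold_locales
  have sub: "P.p.subspace T"
    using assms(3) by (simp add: LR_def)
  let ?E = "closure (T `` {0})"
  have add: "(a + c, b + d) \<in> T" if "(a, b) \<in> T" "(c, d) \<in> T" for a b c d
    using P.p.subspace_add[OF sub that] by simp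
  have diff: "(a - c, b - d) \<in> T" if "(a, b) \<in> T" "(c, d) \<in> T" for a b c d
    using P.p.subspace_diff[OF sub that] by simp
  define z where "z = (SOME y. y \<in> T `` {x})"
  have z: "z \<in> T `` {x}"
    unfolding z_def by (rule someI) (rule y)
  have d: "(0, z - y) \<in> T"
    using diff[of x z x y] y z by simp
  have "(+) (z - y) ` (T `` {0}) = T `` {0}"
  proof (intro equalityI subsetI)
    fix w assume "w \<in> (+) (z - y) ` (T `` {0})"
    then show "w \<in> T `` {0}" using add[OF d, of 0] by auto
  next
    fix w assume "w \<in> T `` {0}"
    then have "w - (z - y) \<in> T `` {0}" using diff[OF _ d, of 0 w] by simp
    then show "w \<in> (+) (z - y) ` (T `` {0})"
      by (intro image_eqI[of _ _ "w - (z - y)"]) simp_all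
  qed
  then have E: "?E = (+) (z - y) ` ?E"
    by (metis closure_translation)
  have "quot_norm ?E z = (INF e\<in>(+) (z - y) ` ?E. norm (z - e))"
    unfolding quot_norm_def by (subst E) (rule refl)
  also have "\<dots> = quot_norm ?E y"
    unfolding quot_norm_def by (simp add: image_image)
  finally show ?thesis
    by (simp add: rel_norm_at_def z_def)
qed

end

theory Submission
  imports Defs
begin

text \<open>
  Boundedness of a linear relation is equivalent to a linear lifting bound: every point \<open>x\<close> of the
  domain has a partner \<open>y\<close> in \<open>T\<close> with \<open>norm y \<le> C * norm x\<close>
  (\<open>rel_bounded_iff_lifts_boundedly\<close>). This removes the quotient norm, and the
  three conditions become statements about sizes of partners.

  The completeness argument common to the two deeper implications is successive approximation
  (\<open>exact_lift_of_approximate_lift\<close>): if \<open>T\<close> is closed and each point of a subspace \<open>S\<close> containing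
  the domain can be matched up to half its norm by a pair in \<open>T\<close> of controlled size, then
  correcting the error repeatedly gives a geometric series of pairs, whose sum lies in \<open>T\<close>
  and matches the point exactly. It is used with two different subspaces.

  \<^item> If \<open>T\<close> is closed and bounded, take for \<open>S\<close> the closure of the domain. A point of it is
    approximated by a point of the domain, which has a controlled partner; exact matching says that
    the closure is contained in the domain.
  \<^item> If \<open>T\<close> and the domain are closed, take for \<open>S\<close> the domain itself. As in the open
    mapping theorem, the Baire property of the domain supplies the approximate matching, and exact
    matching is the lifting bound.

  Conversely, if \<open>T\<close> is bounded with closed domain and closed \<open>T(0)\<close>, a limit of pairs in \<open>T\<close> has its
  first component in the domain; subtracting a pair over that component and small partners
  of the remaining differences leaves a convergent sequence in \<open>T(0)\<close>.

  The scalar field enters only once: a relation linear over it is a real-linear subspace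
  (\<open>LR_imp_real_subspace\<close>).
\<close>

section \<open>Reduction to real scalars\<close>

lemma additive_of_nat_mult:
  fixes f :: "real \<Rightarrow> 'b::real_normed_vector"
  assumes add: "\<And>a b. f (a + b) = f a + f b"
  shows "f (of_nat n * r) = of_nat n *\<^sub>R f r"
proof (induction n)
  case 0
  show ?case using add[of 0 0] by simp
next
  case (Suc n)
  have "f (of_nat (Suc n) * r) = f (r + of_nat n * r)"
    by (simp add: algebra_simps)
  also have "\<dots> = of_nat (Suc n) *\<^sub>R f r"
    unfolding add Suc.IH by (simp add: algebra_simps)
  finally show ?case .
qed

text \<open>
  Additivity and the zero at 1 give period 1, so the linear bound makes the function globally
  bounded; an additive function that is globally bounded vanishes, since its values at multiples grow linearly.
\<close>

lemma additive_linearly_bounded_eq_zero: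
  fixes f :: "real \<Rightarrow> 'b::real_normed_vector"
  assumes add: "\<And>a b. f (a + b) = f a + f b"
    and one: "f 1 = 0"
    and bound: "\<And>r. norm (f r) \<le> C * \<bar>r\<bar>"
  shows "f r = 0"
proof -
  have C: "0 \<le> C"
    using bound[of 1] one by simp
  have mult: "f (of_nat n * s) = of_nat n *\<^sub>R f s" for n s
    by (rule additive_of_nat_mult) (rule add)
  have nat0: "f (of_nat n) = 0" for n
    using mult[of n 1] one by simp
  have neg: "f (- s) = - f s" for s
    using add[of s "- s"] nat0[of 0] by (simp add: eq_neg_iff_add_eq_0 add.commute)
  have int0: "f (of_int k) = 0" for k
    by (cases k rule: int_cases2) (simp_all add: nat0 neg)
  have glob: "norm (f s) \<le> C" for s
  proof -
    have "f s = f (frac s)"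
      using add[of "of_int \<lfloor>s\<rfloor>" "frac s"] int0 by (simp add: frac_def)
    also have "norm \<dots> \<le> C * \<bar>frac s\<bar>" by (rule bound)
    also have "\<dots> \<le> C * 1"
      using C frac_lt_1[of s] frac_ge_0[of s] by (intro mult_left_mono) auto
    finally show ?thesis by simp
  qed
  show ?thesis
  proof (rule ccontr)
    assume "f r \<noteq> 0"
    then obtain n :: nat where "C < of_nat n * norm (f r)"
      using reals_Archimedean3[of "norm (f r)"] by auto
    then show False
      using glob[of "of_nat n * r"] unfolding mult by simp
  qed
qed

lemma normed_vector_space_over_scale_of_real:
  assumes "normed_vector_space_over s"
  shows "s (of_real r) x = r *\<^sub>R x"
proof -
  interpret normed_vector_space_over s by fact
  have "s (of_real r) x - r *\<^sub>R x = 0"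
  proof (rule additive_linearly_bounded_eq_zero)
    show "s (of_real (a + b)) x - (a + b) *\<^sub>R x
        = (s (of_real a) x - a *\<^sub>R x) + (s (of_real b) x - b *\<^sub>R x)" for a b
      by (simp add: scale_left_distrib algebra_simps)
    show "s (of_real 1) x - 1 *\<^sub>R x = 0" by simp
    show "norm (s (of_real q) x - q *\<^sub>R x) \<le> 2 * norm x * \<bar>q\<bar>" for q
      using norm_triangle_ineq4[of "s (of_real q) x" "q *\<^sub>R x"]
      by (simp add: norm_scale mult.commute mult.left_commute)
  qed
  then show ?thesis by simp
qed

lemma LR_imp_real_subspace:
  assumes X: "normed_vector_space_over sX" and Y: "normed_vector_space_over sY"
    and T: "T \<in> LR sX sY"
  shows "subspace T"
proof -
  interpret X: normed_vector_space_over sX by fact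
  interpret Y: normed_vector_space_over sY by fact
  interpret P: vector_space_prod sX sY by unfold_locales
  have sub: "P.p.subspace T"
    using T by (simp add: LR_def)
  show ?thesis
  proof (rule subspaceI)
    show "0 \<in> T" using P.p.subspace_0[OF sub] .
    show "p + q \<in> T" if "p \<in> T" "q \<in> T" for p q
      using P.p.subspace_add[OF sub that] .
    show "r *\<^sub>R p \<in> T" if "p \<in> T" for r p
      using P.p.subspace_scale[OF sub that, of "of_real r"]
      by (cases p) (simp add: P.scale_prod normed_vector_space_over_scale_of_real[OF X]
          normed_vector_space_over_scale_of_real[OF Y])
  qed
qed

lemma rel_norm_at_eq_quot_norm:
  assumes "subspace T" and "(x, y) \<in> T"
  shows "rel_norm_at T x = quot_norm (closure (T `` {0})) y"
  using assms
  by (intro rel_norm_at_eq[OF normed_vector_space_over_scaleR normed_vector_space_over_scaleR])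
    (auto simp: LR_def module_prod_scale_eq_scaleR subspace_raw_def)

section \<open>Boundedness as a lifting bound\<close>

lemma
  assumes "subspace T"
  shows subspace_pair_zero: "(0, 0) \<in> T"
    and subspace_pair_add: "(a, b) \<in> T \<Longrightarrow> (c, d) \<in> T \<Longrightarrow> (a + c, b + d) \<in> T"
    and subspace_pair_diff: "(a, b) \<in> T \<Longrightarrow> (c, d) \<in> T \<Longrightarrow> (a - c, b - d) \<in> T"
    and subspace_pair_scale: "(a, b) \<in> T \<Longrightarrow> (r *\<^sub>R a, r *\<^sub>R b) \<in> T"
  using subspace_0[OF assms] subspace_add[OF assms, of "(a, b)" "(c, d)"]
    subspace_diff[OF assms, of "(a, b)" "(c, d)"] subspace_scale[OF assms, of "(a, b)" r]
  by (simp_all add: zero_prod_def)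

lemma subspace_Domain:
  fixes T :: "('x::real_normed_vector \<times> 'y::real_normed_vector) set"
  assumes "subspace T"
  shows "subspace (Domain T)"
  using linear_subspace_image[OF bounded_linear.linear[OF bounded_linear_fst] assms]
  by (simp add: Domain_fst)

lemma subspace_closure:
  fixes S :: "'a::real_normed_vector set"
  assumes S: "subspace S"
  shows "subspace (closure S)"
proof (rule subspaceI)
  show "0 \<in> closure S"
    using subspace_0[OF S] closure_subset by blast
next
  fix x y assume "x \<in> closure S" "y \<in> closure S"
  then obtain f g where "\<And>n. f n \<in> S" "f \<longlonglongrightarrow> x" "\<And>n. g n \<in> S" "g \<longlonglongrightarrow> y"
    unfolding closure_sequential by blast
  then show "x + y \<in> closure S"
    unfolding closure_sequential
    by (intro exI[of _ "\<lambda>n. f n + g n"]) (auto intro: tendsto_add subspace_add[OF S])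
next
  fix c x assume "x \<in> closure S"
  then obtain f where "\<And>n. f n \<in> S" "f \<longlonglongrightarrow> x"
    unfolding closure_sequential by blast
  then show "c *\<^sub>R x \<in> closure S"
    unfolding closure_sequential
    by (intro exI[of _ "\<lambda>n. c *\<^sub>R f n"]) (auto intro: tendsto_intros subspace_scale[OF S])
qed

lemma quot_norm_le:
  assumes "e \<in> E"
  shows "quot_norm E y \<le> norm (y - e)"
  unfolding quot_norm_def using assms by (intro cINF_lower bdd_belowI[of _ 0]) auto

text \<open>
  The infimum over the closure of a set is an infimum over the set itself, so near-optimal
  representatives can be corrected by genuine elements of \<open>T(0)\<close>.
\<close>

lemma quot_norm_closure_lessD:
  assumes "quot_norm (closure E) y < C" and "E \<noteq> {}"
  shows "\<exists>e\<in>E. norm (y - e) < C"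
proof -
  obtain e where e: "e \<in> closure E" "norm (y - e) < C"
    using assms cInf_lessD[of "(\<lambda>e. norm (y - e)) ` closure E" C]
    by (auto simp: quot_norm_def)
  then obtain e' where e': "e' \<in> E" "dist e' e < C - norm (y - e)"
    using closure_approachable[of e E] by (metis diff_gt_0_iff_gt)
  have "norm (y - e') \<le> norm (y - e) + norm (e - e')"
    using norm_triangle_ineq[of "y - e" "e - e'"] by simp
  then show ?thesis
    using e' by (intro bexI[of _ e']) (auto simp: dist_norm norm_minus_commute)
qed

definition lifts_boundedly :: "real \<Rightarrow> ('x::real_normed_vector \<times> 'y::real_normed_vector) set \<Rightarrow> bool"
  where "lifts_boundedly C T \<longleftrightarrow> (\<forall>x\<in>Domain T. \<exists>y. (x, y) \<in> T \<and> norm y \<le> C * norm x)"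

text \<open>
  A partner attaining the infimum need not exist, so passing from the norm of \<open>T\<close> to a lifting
  bound costs a slightly larger constant.
\<close>

lemma rel_bounded_iff_lifts_boundedly:
  assumes T: "subspace T"
  shows "rel_bounded T \<longleftrightarrow> (\<exists>C\<ge>0. lifts_boundedly C T)"
proof
  assume "rel_bounded T"
  then have fin: "rel_norm T < \<infinity>" by (simp add: rel_bounded_def)
  obtain C where C: "0 \<le> C" "rel_norm T \<le> ereal C"
  proof (cases "rel_norm T")
    case (real r)
    then show ?thesis using that[of "max r 0"] by simp
  qed (use fin that[of 0] in auto)
  have "\<exists>y. (x, y) \<in> T \<and> norm y \<le> (C + 1) * norm x" if x: "x \<in> Domain T" for x
  proof (cases "x = 0")
    case True
    then show ?thesis using subspace_pair_zero[OF T] by auto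
  next
    case False
    define u where "u = (1 / norm x) *\<^sub>R x"
    have u: "u \<in> Domain T" "norm u = 1" "norm x *\<^sub>R u = x"
      using subspace_scale[OF subspace_Domain[OF T] x] False by (auto simp: u_def)
    then obtain v where v: "(u, v) \<in> T" by auto
    have "ereal (rel_norm_at T u) \<le> rel_norm T"
      unfolding rel_norm_def using u by (intro SUP_upper) auto
    with C have "ereal (rel_norm_at T u) \<le> ereal C" by (blast intro: order_trans)
    then have "quot_norm (closure (T `` {0})) v < C + 1"
      using rel_norm_at_eq_quot_norm[OF T v] by simp
    then obtain e where e: "(0, e) \<in> T" "norm (v - e) < C + 1"
      using quot_norm_closure_lessD[of "T `` {0}" v "C + 1"] subspace_pair_zero[OF T] by auto
    have "(u - 0, v - e) \<in> T"
      using subspace_pair_diff[OF T v e(1)] .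
    then have "(x, norm x *\<^sub>R (v - e)) \<in> T"
      using subspace_pair_scale[OF T, of "u - 0" "v - e" "norm x"] u by simp
    moreover have "norm (norm x *\<^sub>R (v - e)) \<le> (C + 1) * norm x"
      using e(2) mult_right_mono[of "norm (v - e)" "C + 1" "norm x"]
      by (simp add: mult.commute)
    ultimately show ?thesis by blast
  qed
  then show "\<exists>C\<ge>0. lifts_boundedly C T"
    using C(1) unfolding lifts_boundedly_def by (intro exI[of _ "C + 1"]) auto
next
  assume "\<exists>C\<ge>0. lifts_boundedly C T"
  then obtain C where C: "0 \<le> C" "lifts_boundedly C T" by blast
  have "rel_norm T \<le> ereal C"
    unfolding rel_norm_def
  proof (rule SUP_least)
    fix x assume "x \<in> {x \<in> Domain T. norm x \<le> 1}"
    then have x: "x \<in> Domain T" "norm x \<le> 1" by auto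
    then obtain y where y: "(x, y) \<in> T" "norm y \<le> C * norm x"
      using C unfolding lifts_boundedly_def by blast
    have "0 \<in> closure (T `` {0})"
      using subspace_pair_zero[OF T] closure_subset[of "T `` {0}"] by auto
    from quot_norm_le[OF this, of y] have "rel_norm_at T x \<le> norm y"
      using rel_norm_at_eq_quot_norm[OF T y(1)] by simp
    also have "\<dots> \<le> C"
      using y(2) mult_left_mono[OF x(2) C(1)] by simp
    finally show "ereal (rel_norm_at T x) \<le> ereal C" by simp
  qed
  then show "rel_bounded T" by (auto simp: rel_bounded_def)
qed

section \<open>Successive approximation\<close>

text \<open>
  Matching the error left by the previous step halves it each time. The pairs used have second
  components dominated by a geometric series, which explains the factor 2, while their first
  components telescope to \<open>x\<close>. Closedness of \<open>T\<close> puts the sum of the series into \<open>T\<close>.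
\<close>

lemma exact_lift_of_approximate_lift:
  fixes T :: "('x::real_normed_vector \<times> 'y::banach) set"
  assumes T: "subspace T" and clT: "closed T"
    and S: "subspace S" and dom: "Domain T \<subseteq> S" and C: "0 \<le> C"
    and approx: "\<And>z. z \<in> S \<Longrightarrow>
      \<exists>x' y'. (x', y') \<in> T \<and> norm (z - x') \<le> norm z / 2 \<and> norm y' \<le> C * norm z"
    and x: "x \<in> S"
  shows "\<exists>y. (x, y) \<in> T \<and> norm y \<le> 2 * C * norm x"
proof -
  obtain a b where ab: "\<And>z. z \<in> S \<Longrightarrow>
      (a z, b z) \<in> T \<and> norm (z - a z) \<le> norm z / 2 \<and> norm (b z) \<le> C * norm z"
    using approx by metis
  define r where "r n = ((\<lambda>z. z - a z) ^^ n) x" for n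
  have r0: "r 0 = x" and rSuc: "r (Suc n) = r n - a (r n)" for n
    by (simp_all add: r_def)
  have rS: "r n \<in> S" for n
  proof (induction n)
    case (Suc n)
    then show ?case
      using ab[OF Suc] dom subspace_diff[OF S Suc] by (auto simp: rSuc)
  qed (simp add: r0 x)
  have rn: "norm (r n) \<le> norm x * (1/2) ^ n" for n
  proof (induction n)
    case (Suc n)
    then show ?case using ab[OF rS[of n]] by (simp add: rSuc)
  qed (simp add: r0)
  have bn: "norm (b (r n)) \<le> C * norm x * (1/2) ^ n" for n
    using ab[OF rS[of n]] mult_left_mono[OF rn[of n] C] by (simp add: mult.assoc)
  have geo: "(\<lambda>n. C * norm x * (1/2) ^ n) sums (C * norm x * 2)"
    using sums_mult[OF geometric_sums[of "1/2 :: real"], of "C * norm x"] by simp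
  have sumn: "summable (\<lambda>n. norm (b (r n)))"
    by (rule summable_comparison_test'[OF sums_summable[OF geo], of 0]) (simp add: bn)
  define y where "y = (\<Sum>n. b (r n))"
  have "norm y \<le> (\<Sum>n. norm (b (r n)))"
    unfolding y_def by (rule summable_norm[OF sumn])
  also have "\<dots> \<le> (\<Sum>n. C * norm x * (1/2) ^ n)"
    by (rule suminf_le[OF bn sumn sums_summable[OF geo]])
  also have "\<dots> = 2 * C * norm x"
    using sums_unique[OF geo] by simp
  finally have ny: "norm y \<le> 2 * C * norm x" .
  have part: "(x - r n, \<Sum>i<n. b (r i)) \<in> T" for n
  proof (induction n)
    case 0
    show ?case using subspace_pair_zero[OF T] by (simp add: r0)
  next
    case (Suc n)
    from subspace_pair_add[OF T Suc conjunct1[OF ab[OF rS[of n]]]]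
    show ?case by (simp add: rSuc algebra_simps)
  qed
  have "(\<lambda>n. norm x * (1/2) ^ n) \<longlonglongrightarrow> norm x * 0"
    by (intro tendsto_intros LIMSEQ_power_zero) simp
  then have "r \<longlonglongrightarrow> 0"
    using Lim_null_comparison[OF always_eventually[OF allI[OF rn]]] by simp
  then have "(\<lambda>n. x - r n) \<longlonglongrightarrow> x - 0"
    by (intro tendsto_intros)
  moreover have "(\<lambda>n. \<Sum>i<n. b (r i)) \<longlonglongrightarrow> y"
    unfolding y_def by (rule summable_LIMSEQ[OF summable_norm_cancel[OF sumn]])
  ultimately have "(\<lambda>n. (x - r n, \<Sum>i<n. b (r i))) \<longlonglongrightarrow> (x, y)"
    by (intro tendsto_Pair) simp_all
  then have "(x, y) \<in> T"
    by (rule closed_sequentially[OF clT part])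
  with ny show ?thesis by blast
qed

text \<open>
  A limit of points of the domain has a point of the domain within half its norm, whose partner is
  controlled; successive approximation turns this into an exact partner of the limit.
\<close>

lemma closed_Domain_if_closed_lifts_boundedly:
  fixes T :: "('x::real_normed_vector \<times> 'y::banach) set"
  assumes T: "subspace T" and clT: "closed T" and C: "0 \<le> C" and lift: "lifts_boundedly C T"
  shows "closed (Domain T)"
proof -
  have "x \<in> Domain T" if x: "x \<in> closure (Domain T)" for x
  proof -
    have "\<exists>y. (x, y) \<in> T \<and> norm y \<le> 2 * (2 * C) * norm x"
    proof (rule exact_lift_of_approximate_lift[OF T clT _ closure_subset _ _ x])
      show "subspace (closure (Domain T))"
        by (rule subspace_closure[OF subspace_Domain[OF T]])
      show "0 \<le> 2 * C" using C by simp
      fix z assume z: "z \<in> closure (Domain T)"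
      show "\<exists>x' y'. (x', y') \<in> T \<and> norm (z - x') \<le> norm z / 2 \<and> norm y' \<le> 2 * C * norm z"
      proof (cases "z = 0")
        case True
        then show ?thesis using subspace_pair_zero[OF T] by auto
      next
        case False
        then obtain x' where x': "x' \<in> Domain T" "dist x' z < norm z / 2"
          using z closure_approachable[of z "Domain T"] by (metis half_gt_zero zero_less_norm_iff)
        obtain y' where y': "(x', y') \<in> T" "norm y' \<le> C * norm x'"
          using lift x'(1) unfolding lifts_boundedly_def by blast
        have near: "norm (z - x') \<le> norm z / 2"
          using x'(2) by (simp add: dist_norm norm_minus_commute)
        have "norm x' \<le> 2 * norm z"
          using near norm_triangle_ineq3[of x' z] by (simp add: norm_minus_commute)
        then have "norm y' \<le> 2 * C * norm z"
          using y'(2) mult_left_mono[OF _ C, of "norm x'" "2 * norm z"] by simp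
        with near y'(1) show ?thesis by blast
      qed
    qed
    then show ?thesis by blast
  qed
  then show ?thesis
    using closure_subset_eq by blast
qed

section \<open>The open mapping argument\<close>

text \<open>
  A closed subset of a complete space is itself completely metrizable, so countably many closures
  covering it cannot all have empty relative interior.
\<close>

lemma Baire_countable_cover:
  fixes S :: "'a::complete_space set" and A :: "nat \<Rightarrow> 'a set"
  assumes clS: "closed S" and ne: "S \<noteq> {}" and sub: "\<And>n. A n \<subseteq> S" and cover: "S \<subseteq> (\<Union>n. A n)"
  shows "\<exists>n x r. x \<in> S \<and> 0 < r \<and> ball x r \<inter> S \<subseteq> closure (A n)"
proof -
  define K where "K n = closure (A n)" for n
  have KS: "K n \<subseteq> S" for n
    unfolding K_def using sub clS by (rule closure_minimal)
  have "\<exists>n. top_of_set S interior_of K n \<noteq> {}"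
  proof (rule ccontr)
    assume "\<not> ?thesis"
    then have empty: "top_of_set S interior_of K n = {}" for n by blast
    have "top_of_set S interior_of \<Union>(range K) = {}"
    proof (rule Baire_category_alt)
      show "completely_metrizable_space (top_of_set S) \<or>
          locally_compact_space (top_of_set S) \<and> regular_space (top_of_set S)"
        using completely_metrizable_space_closedin[OF completely_metrizable_space_euclidean] clS
        by auto
      show "closedin (top_of_set S) L \<and> top_of_set S interior_of L = {}" if "L \<in> range K" for L
        using that empty KS by (auto intro!: closed_subset) (simp add: K_def)
    qed simp
    moreover have "\<Union>(range K) = S"
    proof
      show "\<Union>(range K) \<subseteq> S" using KS by blast
      have "A n \<subseteq> K n" for n unfolding K_def by (rule closure_subset)
      with cover show "S \<subseteq> \<Union>(range K)" by blast
    qed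
    ultimately show False
      using ne interior_of_topspace[of "top_of_set S"] by simp
  qed
  then obtain n x where "x \<in> top_of_set S interior_of K n" by blast
  then obtain U where U: "openin (top_of_set S) U" "x \<in> U" "U \<subseteq> K n"
    unfolding interior_of_def by blast
  then obtain r where r: "0 < r" "ball x r \<inter> S \<subseteq> U"
    unfolding openin_contains_ball by blast
  have "x \<in> S" using U KS by blast
  moreover have "ball x r \<inter> S \<subseteq> closure (A n)"
    using r(2) U(3) unfolding K_def by (rule subset_trans)
  ultimately show ?thesis using r(1) by blast
qed

text \<open>
  The points having a partner of norm at most \<open>n\<close> exhaust the domain, so for some \<open>n\<close> their closure
  contains a relative ball. Differences of such points approximate every point of the domain near
  the origin, and scaling gives the approximate lift of any point.
\<close>

lemma lifts_boundedly_if_closed: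
  fixes T :: "('x::banach \<times> 'y::banach) set"
  assumes T: "subspace T" and clT: "closed T" and clD: "closed (Domain T)"
  shows "\<exists>C\<ge>0. lifts_boundedly C T"
proof -
  define A where "A n = {x. \<exists>y. (x, y) \<in> T \<and> norm y \<le> real n}" for n :: nat
  have D: "subspace (Domain T)" by (rule subspace_Domain[OF T])
  have "\<exists>n x r. x \<in> Domain T \<and> 0 < r \<and> ball x r \<inter> Domain T \<subseteq> closure (A n)"
  proof (rule Baire_countable_cover[OF clD])
    show "Domain T \<noteq> {}" using subspace_0[OF D] by blast
    show "A n \<subseteq> Domain T" for n by (auto simp: A_def)
    show "Domain T \<subseteq> (\<Union>n. A n)"
    proof
      fix x assume "x \<in> Domain T"
      then obtain y where y: "(x, y) \<in> T" by auto
      obtain n where "norm y \<le> real n" using real_arch_simple by blast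
      with y show "x \<in> (\<Union>n. A n)" by (auto simp: A_def)
    qed
  qed
  then obtain n x0 r where x0: "x0 \<in> Domain T" and r: "0 < r"
    and ball: "ball x0 r \<inter> Domain T \<subseteq> closure (A n)" by blast
  define C where "C = 4 * real n / r"
  have C: "0 \<le> C" using r by (simp add: C_def)
  have approx: "\<exists>x' y'. (x', y') \<in> T \<and> norm (z - x') \<le> norm z / 2 \<and> norm y' \<le> C * norm z"
    if z: "z \<in> Domain T" for z
  proof (cases "z = 0")
    case True
    then show ?thesis using subspace_pair_zero[OF T] by auto
  next
    case False
    \<comment> \<open>The vector \<open>w\<close> is \<open>z\<close> scaled to norm \<open>r / 2\<close>; two errors of \<open>r / 8\<close> make half that norm.\<close>
    define t where "t = r / (2 * norm z)"
    define w where "w = t *\<^sub>R z"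
    have t: "0 < t" using r False by (simp add: t_def)
    have w: "w \<in> Domain T" "norm w = r / 2"
      using subspace_scale[OF D z] r False by (auto simp: w_def t_def)
    have "x0 + w \<in> closure (A n)"
      using ball subspace_add[OF D x0 w(1)] w(2) r by (auto simp: dist_norm subset_iff)
    then obtain u p where u: "(u, p) \<in> T" "norm p \<le> real n" "dist u (x0 + w) < r / 8"
      using r closure_approachable[of "x0 + w" "A n"] by (auto simp: A_def dest!: spec[of _ "r / 8"])
    have "x0 \<in> closure (A n)"
      using ball x0 r by auto
    then obtain v q where v: "(v, q) \<in> T" "norm q \<le> real n" "dist v x0 < r / 8"
      using r closure_approachable[of x0 "A n"] by (auto simp: A_def dest!: spec[of _ "r / 8"])
    have "w - (u - v) = (v - x0) - (u - (x0 + w))" by simp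
    then have "norm (w - (u - v)) \<le> norm (v - x0) + norm (u - (x0 + w))"
      by (metis norm_triangle_ineq4)
    then have err: "norm (w - (u - v)) \<le> r / 4"
      using u(3) v(3) unfolding dist_norm by linarith
    have size: "norm (p - q) \<le> 2 * real n"
      using norm_triangle_ineq4[of p q] u(2) v(2) by simp
    let ?x = "(1 / t) *\<^sub>R (u - v)" and ?y = "(1 / t) *\<^sub>R (p - q)"
    have "(?x, ?y) \<in> T"
      by (intro subspace_pair_scale[OF T] subspace_pair_diff[OF T] u v)
    moreover have "norm (z - ?x) \<le> norm z / 2"
    proof -
      have "z - ?x = (1 / t) *\<^sub>R (w - (u - v))"
        using t by (simp add: w_def scaleR_right_diff_distrib)
      then have "norm (z - ?x) = (1 / t) * norm (w - (u - v))"
        using t by simp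
      also have "\<dots> \<le> (1 / t) * (r / 4)"
        using t err by (intro mult_left_mono) auto
      also have "\<dots> = norm z / 2"
        using r False by (simp add: t_def)
      finally show ?thesis .
    qed
    moreover have "norm ?y \<le> C * norm z"
    proof -
      have "norm ?y = (1 / t) * norm (p - q)"
        using t by simp
      also have "\<dots> \<le> (1 / t) * (2 * real n)"
        using t size by (intro mult_left_mono) auto
      also have "\<dots> = C * norm z"
        using r False by (simp add: t_def C_def)
      finally show ?thesis .
    qed
    ultimately show ?thesis by blast
  qed
  have "lifts_boundedly (2 * C) T"
    unfolding lifts_boundedly_def
    using exact_lift_of_approximate_lift[OF T clT D subset_refl C approx] by blast
  with C show ?thesis by (intro exI[of _ "2 * C"]) simp
qed

section \<open>Closedness of the relation\<close>

lemma closed_Image_zero: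
  fixes T :: "('x::real_normed_vector \<times> 'y::real_normed_vector) set"
  assumes "closed T"
  shows "closed (T `` {0})"
proof -
  have "T `` {0} = Pair 0 -` T" by auto
  also have "closed \<dots>"
    by (intro continuous_closed_vimage assms continuous_intros)
  finally show ?thesis .
qed

text \<open>
  The pairs of a convergent sequence differ from a fixed pair over the limit of the first
  components by pairs whose first components tend to 0. The lifting bound gives partners of these
  that tend to 0 as well, and removing them leaves elements of \<open>T(0)\<close>.
\<close>

lemma closed_if_lifts_boundedly:
  fixes T :: "('x::real_normed_vector \<times> 'y::real_normed_vector) set"
  assumes T: "subspace T" and lift: "lifts_boundedly C T"
    and clD: "closed (Domain T)" and cl0: "closed (T `` {0})"
  shows "closed T"
  unfolding closed_sequential_limits
proof (intro allI impI, elim conjE)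
  fix s and l :: "'x \<times> 'y"
  assume sT: "\<forall>n. s n \<in> T" and lim: "s \<longlonglongrightarrow> l"
  have limx: "(\<lambda>n. fst (s n)) \<longlonglongrightarrow> fst l" and limy: "(\<lambda>n. snd (s n)) \<longlonglongrightarrow> snd l"
    using lim by (rule tendsto_fst, rule tendsto_snd)
  have pair: "(fst (s n), snd (s n)) \<in> T" for n
    using sT by simp
  then have "fst l \<in> Domain T"
    using closed_sequentially[OF clD _ limx] by blast
  then obtain w where w: "(fst l, w) \<in> T" by auto
  have dT: "(fst (s n) - fst l, snd (s n) - w) \<in> T" for n
    by (rule subspace_pair_diff[OF T pair w])
  then have "\<forall>n. \<exists>z. (fst (s n) - fst l, z) \<in> T \<and> norm z \<le> C * norm (fst (s n) - fst l)"
    using lift unfolding lifts_boundedly_def by blast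
  then obtain z where z: "\<And>n. (fst (s n) - fst l, z n) \<in> T"
    and zn: "\<And>n. norm (z n) \<le> C * norm (fst (s n) - fst l)"
    by metis
  have "(\<lambda>n. C * norm (fst (s n) - fst l)) \<longlonglongrightarrow> C * norm (fst l - fst l)"
    by (intro tendsto_intros limx)
  then have "z \<longlonglongrightarrow> 0"
    using Lim_null_comparison[OF always_eventually[OF allI[OF zn]]] by simp
  then have "(\<lambda>n. snd (s n) - w - z n) \<longlonglongrightarrow> snd l - w - 0"
    by (intro tendsto_intros limy)
  moreover have "snd (s n) - w - z n \<in> T `` {0}" for n
    using subspace_pair_diff[OF T dT z, of n n] by simp
  ultimately have "snd l - w \<in> T `` {0}"
    using closed_sequentially[OF cl0, of "\<lambda>n. snd (s n) - w - z n" "snd l - w - 0"] by simp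
  then have "(0 + fst l, snd l - w + w) \<in> T"
    by (intro subspace_pair_add[OF T] w) simp
  then show "l \<in> T" by simp
qed

section \<open>The equivalence\<close>

theorem theorem5p1:
  fixes sX :: "'k::real_normed_field \<Rightarrow> 'x::banach \<Rightarrow> 'x"
    and sY :: "'k \<Rightarrow> 'y::banach \<Rightarrow> 'y"
    and T :: "('x \<times> 'y) set"
  assumes "normed_vector_space_over sX"
    and "normed_vector_space_over sY"
    and "T \<in> LR sX sY"
  shows "((closed T \<and> closed (Domain T)) \<longleftrightarrow>
           (rel_bounded T \<and> closed (Domain T) \<and> closed (T `` {0})))
       \<and> ((rel_bounded T \<and> closed (Domain T) \<and> closed (T `` {0})) \<longleftrightarrow>
           (rel_bounded T \<and> closed T))"
proof -
  have T: "subspace T"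
    by (rule LR_imp_real_subspace[OF assms])
  note bounded = rel_bounded_iff_lifts_boundedly[OF T]
  have "rel_bounded T" if "closed T" "closed (Domain T)"
    using lifts_boundedly_if_closed[OF T that] bounded by simp
  moreover have "closed T" if "rel_bounded T" "closed (Domain T)" "closed (T `` {0})"
    using closed_if_lifts_boundedly[OF T _ that(2,3)] that(1) bounded by blast
  moreover have "closed (Domain T)" if "rel_bounded T" "closed T"
    using closed_Domain_if_closed_lifts_boundedly[OF T that(2)] that(1) bounded by blast
  moreover have "closed (T `` {0})" if "closed T"
    by (rule closed_Image_zero[OF that])
  ultimately show ?thesis by blast
qed

end
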